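(* Let $\mathcal{A}\subseteq\mathcal{P}(\Omega)$ be a dictionary of atoms such that $\mathcal{M}(\mathcal{A})$ is identifiable, let $W:\mathcal{A}\times\mathcal{A}\to\mathbb{R}_{\ge 0}$ be a finite metric on $\mathcal{A}$, and let $\varphi\in\mathrm{MI}$. For $\nu_i=\sum_{j=1}^{J_i}\lambda_{i,j}\mu_{i,j}\in\mathcal{M}(\mathcal{A})$ with $\mu_{i,j}\in\mathcal{A}$ and $\lambda_i=(\lambda_{i,1},\dots,\lambda_{i,J_i})\in\Delta^{J_i}$, $i\in\{0,1\}$, put $$W_{\mathcal{A},\varphi}(\nu_0,\nu_1):=\varphi^{-1}\Big(\inf_{w\in\Pi(\lambda_0,\lambda_1)}\sum_{j_0=1}^{J_0}\sum_{j_1=1}^{J_1}w_{j_0,j_1}\,\varphi\big(W(\mu_{0,j_0},\mu_{1,j_1})\big)\Big).$$ Then $W_{\mathcal{A},\varphi}$ defines a metric on $\mathcal{M}(\mathcal{A})$.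
   Context: $(\mathcal{X},d)$ is a Polish metric space, $\Omega\subseteq\mathcal{X}$ is a fixed Borel set, and $\mathcal{P}(\Omega)$ is the set of Borel probability measures on $\Omega$. A dictionary of atoms is a nonempty subset $\mathcal{A}\subseteq\mathcal{P}(\Omega)$. $\Delta^J=\{(\lambda_1,\dots,\lambda_J)\in[0,1]^J:\sum_j\lambda_j=1\}$. $\mathcal{M}(\mathcal{A})$ is the set of finite mixtures $\sum_{j=1}^J\lambda_j\mu_j$ with $J\ge1$, $\mu_j\in\mathcal{A}$, $(\lambda_j)_j\in\Delta^J$. Identifiability of $\mathcal{M}(\mathcal{A})$: for any two mixtures $\nu_i=\sum_{j=1}^{J_i}\lambda_{i,j}\mu_{i,j}$ ($i=0,1$) with all $\lambda_{i,j}>0$ and, for each $i$, the atoms $\mu_{i,1},\dots,\mu_{i,J_i}\in\mathcal{A}$ pairwise distinct, one has $\nu_0=\nu_1$ if and only if $J_0=J_1$ and, after reordering indices, $\lambda_{0,j}=\lambda_{1,j}$ and $\mu_{0,j}=\mu_{1,j}$ for all $j$. (Identifiability ensures that the value of $W_{\mathcal{A},\varphi}(\nu_0,\nu_1)$ does not depend on the chosen representations.) $\mathrm{MI}$ is the set of increasing bijections $\varphi:\mathbb{R}_{\ge0}\to\mathbb{R}_{\ge0}$ such that $F_\varphi(x_0,x_1):=\varphi(\varphi^{-1}(x_0)+\varphi^{-1}(x_1))$ is concave on $\mathbb{R}_{\ge0}^2$. $\Pi(\lambda_0,\lambda_1)$ is the set of matrices $w=(w_{j_0,j_1})\in\mathbb{R}_{\ge0}^{J_0\times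 J_1}$ with $\sum_{j_1}w_{j_0,j_1}=\lambda_{0,j_0}$ for all $j_0$ and $\sum_{j_0}w_{j_0,j_1}=\lambda_{1,j_1}$ for all $j_1$. *)

theory Defs
  imports "HOL-Probability.Probability"
begin

definition borel_probs :: "'x::topological_space set \<Rightarrow> 'x measure set" where
  "borel_probs \<Omega> = {\<mu>. prob_space \<mu> \<and> sets \<mu> = sets (restrict_space borel \<Omega>)}"

text \<open>Finite families indexed by \<open>1, \<dots>, J\<close> are functions on \<^typ>\<open>nat\<close> whose values outside
  \<open>{1..J}\<close> are irrelevant.\<close>

definition prob_simplex :: "nat \<Rightarrow> (nat \<Rightarrow> real) set" where
  "prob_simplex J = {l. (\<forall>j\<in>{1..J}. 0 \<le> l j \<and> l j \<le> 1) \<and> (\<Sum>j=1..J. l j) = 1}"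

definition mixture ::
    "'x::topological_space set \<Rightarrow> nat \<Rightarrow> (nat \<Rightarrow> real) \<Rightarrow> (nat \<Rightarrow> 'x measure) \<Rightarrow> 'x measure" where
  "mixture \<Omega> J l \<mu> = measure_of \<Omega> (sets (restrict_space borel \<Omega>))
     (\<lambda>B. \<Sum>j=1..J. ennreal (l j) * emeasure (\<mu> j) B)"

text \<open>Weights may vanish and atoms may be repeated.\<close>

definition mixture_rep ::
    "'x measure set \<Rightarrow> nat \<Rightarrow> (nat \<Rightarrow> real) \<Rightarrow> (nat \<Rightarrow> 'x measure) \<Rightarrow> bool" where
  "mixture_rep A J l \<mu> \<longleftrightarrow> J \<ge> 1 \<and> l \<in> prob_simplex J \<and> (\<forall>j\<in>{1..J}. \<mu> j \<in> A)"

definition mixtures :: "'x::topological_space set \<Rightarrow> 'x measure set \<Rightarrow> 'x measure set" where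
  "mixtures \<Omega> A = {mixture \<Omega> J l \<mu> | J l \<mu>. mixture_rep A J l \<mu>}"

definition identifiable :: "'x::topological_space set \<Rightarrow> 'x measure set \<Rightarrow> bool" where
  "identifiable \<Omega> A \<longleftrightarrow>
     (\<forall>J0 J1 l0 l1 \<mu>0 \<mu>1.
        mixture_rep A J0 l0 \<mu>0 \<and> (\<forall>j\<in>{1..J0}. l0 j > 0) \<and> inj_on \<mu>0 {1..J0} \<and>
        mixture_rep A J1 l1 \<mu>1 \<and> (\<forall>j\<in>{1..J1}. l1 j > 0) \<and> inj_on \<mu>1 {1..J1} \<longrightarrow>
        (mixture \<Omega> J0 l0 \<mu>0 = mixture \<Omega> J1 l1 \<mu>1 \<longleftrightarrow>
           J0 = J1 \<and>
           (\<exists>p. bij_betw p {1..J0} {1..J1} \<and>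
                (\<forall>j\<in>{1..J0}. l0 j = l1 (p j) \<and> \<mu>0 j = \<mu>1 (p j)))))"

text \<open>Only the values of \<open>d\<close> on \<open>S \<times> S\<close> matter: \<^locale>\<open>Metric_space\<close> also asks for symmetry and
  nonnegativity off the carrier, so \<open>d\<close> is first replaced by \<open>0\<close> there.\<close>

definition metric_on :: "'a set \<Rightarrow> ('a \<Rightarrow> 'a \<Rightarrow> real) \<Rightarrow> bool" where
  "metric_on S d \<longleftrightarrow> Metric_space S (\<lambda>x y. if x \<in> S \<and> y \<in> S then d x y else 0)"

abbreviation nonneg_inv :: "(real \<Rightarrow> real) \<Rightarrow> real \<Rightarrow> real" where
  "nonneg_inv \<phi> \<equiv> inv_into {0..} \<phi>"

definition MI :: "(real \<Rightarrow> real) set" where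
  "MI = {\<phi>. bij_betw \<phi> {0..} {0..} \<and> strict_mono_on {0..} \<phi> \<and>
            concave_on ({0..} \<times> {0..})
              (\<lambda>(x0, x1). \<phi> (nonneg_inv \<phi> x0 + nonneg_inv \<phi> x1))}"

definition couplings ::
    "nat \<Rightarrow> (nat \<Rightarrow> real) \<Rightarrow> nat \<Rightarrow> (nat \<Rightarrow> real) \<Rightarrow> (nat \<Rightarrow> nat \<Rightarrow> real) set" where
  "couplings J0 l0 J1 l1 =
     {w. (\<forall>j0\<in>{1..J0}. \<forall>j1\<in>{1..J1}. 0 \<le> w j0 j1) \<and>
         (\<forall>j0\<in>{1..J0}. (\<Sum>j1=1..J1. w j0 j1) = l0 j0) \<and>
         (\<forall>j1\<in>{1..J1}. (\<Sum>j0=1..J0. w j0 j1) = l1 j1)}"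

definition rep_dist ::
    "('x measure \<Rightarrow> 'x measure \<Rightarrow> real) \<Rightarrow> (real \<Rightarrow> real) \<Rightarrow>
     nat \<Rightarrow> (nat \<Rightarrow> real) \<Rightarrow> (nat \<Rightarrow> 'x measure) \<Rightarrow>
     nat \<Rightarrow> (nat \<Rightarrow> real) \<Rightarrow> (nat \<Rightarrow> 'x measure) \<Rightarrow> real" where
  "rep_dist W \<phi> J0 l0 \<mu>0 J1 l1 \<mu>1 =
     nonneg_inv \<phi> (INF w\<in>couplings J0 l0 J1 l1.
       \<Sum>j0=1..J0. \<Sum>j1=1..J1. w j0 j1 * \<phi> (W (\<mu>0 j0) (\<mu>1 j1)))"

text \<open>The common value of \<^const>\<open>rep_dist\<close> over all representations of \<open>\<nu>0\<close> and \<open>\<nu>1\<close>; meaningful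
  only where that value is independent of the representations.\<close>

definition mixture_dist ::
    "'x::topological_space set \<Rightarrow> 'x measure set \<Rightarrow> ('x measure \<Rightarrow> 'x measure \<Rightarrow> real) \<Rightarrow>
     (real \<Rightarrow> real) \<Rightarrow> 'x measure \<Rightarrow> 'x measure \<Rightarrow> real" where
  "mixture_dist \<Omega> A W \<phi> \<nu>0 \<nu>1 =
     (THE r. \<exists>J0 l0 \<mu>0 J1 l1 \<mu>1.
        mixture_rep A J0 l0 \<mu>0 \<and> \<nu>0 = mixture \<Omega> J0 l0 \<mu>0 \<and>
        mixture_rep A J1 l1 \<mu>1 \<and> \<nu>1 = mixture \<Omega> J1 l1 \<mu>1 \<and>
        r = rep_dist W \<phi> J0 l0 \<mu>0 J1 l1 \<mu>1)"

end

theory Submission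
  imports Defs
begin

text \<open>
  All reasoning takes place on representations \<open>(J, l, \<mu>)\<close> of mixtures, between which
  \<^const>\<open>rep_dist\<close> turns out to be a pseudometric \<open>D\<close>.

  The triangle inequality for \<open>D\<close> rests on the concavity condition in
  \<^const>\<open>MI\<close>. Given couplings
  \<open>w\<close> and \<open>v\<close> with a common marginal, glue them into a plan on triples of indices
  (\<open>glue_couplings\<close>). Along each triple \<open>\<phi> (W a c) \<le> \<phi> (W a b + W b c) = F (\<phi> (W a b), \<phi> (W b c))\<close>
  where \<open>F (x, y) = \<phi> (\<phi>\<inverse> x + \<phi>\<inverse> y)\<close>; averaging over the plan, Jensen's inequality for the
  concave function \<open>F\<close> bounds the cost of the outer marginal by \<open>F (cost w, cost v)\<close>
  (\<open>glued_cost\<close>). Applying \<open>\<phi>\<inverse>\<close> and taking nearly optimal \<open>w\<close> and \<open>v\<close> gives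
  \<open>dist_rep_triangle\<close>.

  Adding up the weights of equal atoms turns a representation into a finitely supported probability
  on \<open>A\<close>, its \<open>atom_weight\<close>. Two representations have the same mixture iff they have the same
  \<open>atom_weight\<close> (\<open>identifiable_mixture_eq_iff\<close>), and \<open>D\<close> vanishes between them in exactly that
  case (\<open>dist_rep_eq_0_iff\<close>): mass can stay at its atom if the weights agree, while otherwise
  some mass moves between distinct atoms, at a cost per unit that is bounded below because only
  finitely many pairs occur.

  Hence \<open>D\<close> vanishes between representations of the same mixture, and the triangle inequality
  makes \<open>D\<close> independent of the representations chosen. The metric axioms on mixtures are then
  those already known for \<open>D\<close>.
\<close>

section \<open>Couplings of finite weights\<close>

definition coupling_cost :: "nat \<Rightarrow> nat \<Rightarrow> (nat \<Rightarrow> nat \<Rightarrow> real) \<Rightarrow> (nat \<Rightarrow> nat \<Rightarrow> real) \<Rightarrow> real" where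
  "coupling_cost J0 J1 c w = (\<Sum>i=1..J0. \<Sum>j=1..J1. w i j * c i j)"

lemma coupling_cost_nonneg:
  assumes "w \<in> couplings J0 l0 J1 l1"
    and "\<And>i j. i \<in> {1..J0} \<Longrightarrow> j \<in> {1..J1} \<Longrightarrow> 0 \<le> c i j"
  shows "0 \<le> coupling_cost J0 J1 c w"
  using assms unfolding coupling_cost_def
  by (intro sum_nonneg mult_nonneg_nonneg) (auto simp: couplings_def)

lemma product_coupling:
  assumes "l0 \<in> prob_simplex J0" and "l1 \<in> prob_simplex J1"
  shows "(\<lambda>i j. l0 i * l1 j) \<in> couplings J0 l0 J1 l1"
  using assms unfolding couplings_def prob_simplex_def
  by (auto simp flip: sum_distrib_left sum_distrib_right)

lemma transpose_coupling:
  assumes "w \<in> couplings J0 l0 J1 l1"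
  shows "(\<lambda>j i. w i j) \<in> couplings J1 l1 J0 l0"
  using assms unfolding couplings_def by auto

text \<open>Discrete gluing lemma: choose \<open>i\<close> and \<open>k\<close> independently given \<open>j\<close>. Where \<open>l1 j\<close> vanishes,
  so do column \<open>j\<close> of \<open>w\<close> and row \<open>j\<close> of \<open>v\<close>, hence division by zero does no harm.\<close>

lemma glue_couplings:
  assumes w: "w \<in> couplings J0 l0 J1 l1" and v: "v \<in> couplings J1 l1 J2 l2"
  obtains g :: "nat \<Rightarrow> nat \<Rightarrow> nat \<Rightarrow> real" where
    "\<And>i j k. i \<in> {1..J0} \<Longrightarrow> j \<in> {1..J1} \<Longrightarrow> k \<in> {1..J2} \<Longrightarrow> 0 \<le> g i j k"
    and "\<And>i j. i \<in> {1..J0} \<Longrightarrow> j \<in> {1..J1} \<Longrightarrow> (\<Sum>k=1..J2. g i j k) = w i j"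
    and "\<And>j k. j \<in> {1..J1} \<Longrightarrow> k \<in> {1..J2} \<Longrightarrow> (\<Sum>i=1..J0. g i j k) = v j k"
proof
  let ?g = "\<lambda>i j k. w i j * v j k / l1 j"
  have w0: "0 \<le> w i j" if "i \<in> {1..J0}" "j \<in> {1..J1}" for i j
    using w that by (auto simp: couplings_def)
  have v0: "0 \<le> v j k" if "j \<in> {1..J1}" "k \<in> {1..J2}" for j k
    using v that by (auto simp: couplings_def)
  have w_col: "(\<Sum>i=1..J0. w i j) = l1 j" if "j \<in> {1..J1}" for j
    using w that by (auto simp: couplings_def)
  have v_row: "(\<Sum>k=1..J2. v j k) = l1 j" if "j \<in> {1..J1}" for j
    using v that by (auto simp: couplings_def)
  have l1: "0 \<le> l1 j" if "j \<in> {1..J1}" for j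
    unfolding w_col[OF that, symmetric] using w0 that by (intro sum_nonneg) auto
  show "0 \<le> ?g i j k" if "i \<in> {1..J0}" "j \<in> {1..J1}" "k \<in> {1..J2}" for i j k
    using w0 v0 l1 that by simp
  show "(\<Sum>k=1..J2. ?g i j k) = w i j" if "i \<in> {1..J0}" "j \<in> {1..J1}" for i j
  proof -
    have "w i j = 0" if "l1 j = 0"
      using sum_nonneg_0[of "{1..J0}" "\<lambda>i. w i j" i] w_col w0 that
        \<open>i \<in> {1..J0}\<close> \<open>j \<in> {1..J1}\<close> by simp
    moreover have "(\<Sum>k=1..J2. ?g i j k) = w i j * l1 j / l1 j"
      using v_row[OF that(2)] by (simp flip: sum_divide_distrib sum_distrib_left)
    ultimately show ?thesis by auto
  qed
  show "(\<Sum>i=1..J0. ?g i j k) = v j k" if "j \<in> {1..J1}" "k \<in> {1..J2}" for j k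
  proof -
    have "v j k = 0" if "l1 j = 0"
      using sum_nonneg_0[of "{1..J2}" "v j" k] v_row v0 that
        \<open>j \<in> {1..J1}\<close> \<open>k \<in> {1..J2}\<close> by simp
    moreover have "(\<Sum>i=1..J0. ?g i j k) = l1 j * v j k / l1 j"
      using w_col[OF that(1)] by (simp flip: sum_divide_distrib sum_distrib_right)
    ultimately show ?thesis by auto
  qed
qed

section \<open>The concave modulus\<close>

lemma
  assumes "\<phi> \<in> MI"
  shows MI_nonneg: "0 \<le> x \<Longrightarrow> 0 \<le> \<phi> x"
    and MI_inv_nonneg: "0 \<le> y \<Longrightarrow> 0 \<le> nonneg_inv \<phi> y"
    and MI_f_inv: "0 \<le> y \<Longrightarrow> \<phi> (nonneg_inv \<phi> y) = y"
    and MI_inv_f: "0 \<le> x \<Longrightarrow> nonneg_inv \<phi> (\<phi> x) = x"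
    and MI_less_iff: "0 \<le> x \<Longrightarrow> 0 \<le> x' \<Longrightarrow> \<phi> x < \<phi> x' \<longleftrightarrow> x < x'"
proof -
  have bij: "bij_betw \<phi> {0..} {0..}" and mono: "strict_mono_on {0..} \<phi>"
    using assms by (auto simp: MI_def)
  show "0 \<le> x \<Longrightarrow> 0 \<le> \<phi> x"
    using bij by (auto simp: bij_betw_def)
  show "0 \<le> y \<Longrightarrow> 0 \<le> nonneg_inv \<phi> y"
    using bij inv_into_into[of y \<phi> "{0..}"] by (auto simp: bij_betw_def)
  show "0 \<le> y \<Longrightarrow> \<phi> (nonneg_inv \<phi> y) = y"
    using bij by (simp add: bij_betw_def f_inv_into_f)
  show "0 \<le> x \<Longrightarrow> nonneg_inv \<phi> (\<phi> x) = x"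
    using bij by (simp add: bij_betw_def)
  show "0 \<le> x \<Longrightarrow> 0 \<le> x' \<Longrightarrow> \<phi> x < \<phi> x' \<longleftrightarrow> x < x'"
    using strict_mono_on_less[OF mono] by simp
qed

lemma MI_le_iff:
  assumes "\<phi> \<in> MI" "0 \<le> x" "0 \<le> x'"
  shows "\<phi> x \<le> \<phi> x' \<longleftrightarrow> x \<le> x'"
  using MI_less_iff[OF assms(1,3,2)] by linarith

lemma MI_zero:
  assumes "\<phi> \<in> MI"
  shows "\<phi> 0 = 0"
  using MI_f_inv[OF assms, of 0] MI_inv_nonneg[OF assms, of 0] MI_nonneg[OF assms, of 0]
    MI_le_iff[OF assms, of 0 "nonneg_inv \<phi> 0"] by simp

lemma MI_inv_mono:
  assumes "\<phi> \<in> MI" "0 \<le> y" "y \<le> y'"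
  shows "nonneg_inv \<phi> y \<le> nonneg_inv \<phi> y'"
proof -
  have "0 \<le> y'" using assms by simp
  then show ?thesis
    using assms MI_le_iff[OF assms(1), of "nonneg_inv \<phi> y" "nonneg_inv \<phi> y'"]
    by (simp add: MI_f_inv MI_inv_nonneg)
qed

text \<open>Jensen's inequality for the concave function
  \<open>(x, y) \<mapsto> \<phi> (\<phi>\<inverse> x + \<phi>\<inverse> y)\<close>, evaluated at the points \<open>(\<phi> (x s), \<phi> (y s))\<close>.\<close>

lemma MI_Jensen:
  assumes phi: "\<phi> \<in> MI" and fin: "finite S"
    and p0: "\<And>s. s \<in> S \<Longrightarrow> 0 \<le> p s" and p1: "(\<Sum>s\<in>S. p s) = 1"
    and x: "\<And>s. s \<in> S \<Longrightarrow> 0 \<le> x s" and y: "\<And>s. s \<in> S \<Longrightarrow> 0 \<le> y s"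
  shows "(\<Sum>s\<in>S. p s * \<phi> (x s + y s))
    \<le> \<phi> (nonneg_inv \<phi> (\<Sum>s\<in>S. p s * \<phi> (x s)) + nonneg_inv \<phi> (\<Sum>s\<in>S. p s * \<phi> (y s)))"
proof -
  define F where "F = (\<lambda>(x0, x1). \<phi> (nonneg_inv \<phi> x0 + nonneg_inv \<phi> x1))"
  have conv: "convex_on ({0..} \<times> {0..}) (\<lambda>z. - F z)"
    using phi unfolding MI_def F_def concave_on_def by simp
  have ne: "S \<noteq> {}" using p1 by auto
  have "- F (\<Sum>s\<in>S. p s *\<^sub>R (\<phi> (x s), \<phi> (y s))) \<le> (\<Sum>s\<in>S. p s * - F (\<phi> (x s), \<phi> (y s)))"
    using MI_nonneg[OF phi] p0 x y by (intro convex_on_sum[OF fin ne conv p1]) auto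
  moreover have "(\<Sum>s\<in>S. p s *\<^sub>R (\<phi> (x s), \<phi> (y s)))
      = ((\<Sum>s\<in>S. p s * \<phi> (x s)), (\<Sum>s\<in>S. p s * \<phi> (y s)))"
    by (simp add: prod_eq_iff fst_sum snd_sum)
  moreover have "(\<Sum>s\<in>S. p s * - F (\<phi> (x s), \<phi> (y s))) = - (\<Sum>s\<in>S. p s * \<phi> (x s + y s))"
    using x y by (simp add: F_def MI_inv_f[OF phi] sum_negf)
  ultimately show ?thesis
    by (simp add: F_def)
qed

section \<open>Weights carried by the atoms\<close>

text \<open>Merging repeated indices: this is the image of the weights under \<open>\<mu>\<close>, a finitely supported
  probability on the set of atoms. It is all that a representation says about its mixture.\<close>

definition atom_weight :: "nat \<Rightarrow> (nat \<Rightarrow> real) \<Rightarrow> (nat \<Rightarrow> 'a) \<Rightarrow> 'a \<Rightarrow> real" where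
  "atom_weight J l \<mu> a = (\<Sum>j=1..J. if \<mu> j = a then l j else 0)"

lemma atom_weight_nonneg:
  assumes "l \<in> prob_simplex J"
  shows "0 \<le> atom_weight J l \<mu> a"
  using assms unfolding atom_weight_def prob_simplex_def by (intro sum_nonneg) auto

lemma atom_weight_eq_0:
  assumes "a \<notin> \<mu> ` {1..J}"
  shows "atom_weight J l \<mu> a = 0"
  using assms unfolding atom_weight_def by (intro sum.neutral) auto

lemma atom_weight_pos:
  assumes "l \<in> prob_simplex J" "j \<in> {1..J}" "0 < l j"
  shows "0 < atom_weight J l \<mu> (\<mu> j)"
proof -
  have "l j \<le> atom_weight J l \<mu> (\<mu> j)"
    using member_le_sum[of j "{1..J}" "\<lambda>i. if \<mu> i = \<mu> j then l i else 0"] assms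
    by (auto simp: atom_weight_def prob_simplex_def)
  with assms(3) show ?thesis by simp
qed

lemma sum_atom_weight:
  assumes "finite S" "\<mu> ` {1..J} \<subseteq> S"
  shows "(\<Sum>a\<in>S. atom_weight J l \<mu> a) = (\<Sum>j=1..J. l j)"
proof -
  have "(\<Sum>a\<in>S. atom_weight J l \<mu> a) = (\<Sum>j=1..J. \<Sum>a\<in>S. if \<mu> j = a then l j else 0)"
    unfolding atom_weight_def by (rule sum.swap)
  also have "\<dots> = (\<Sum>j=1..J. l j)"
    using assms by (intro sum.cong) (auto simp: image_subset_iff)
  finally show ?thesis .
qed

lemma sum_ennreal_atom_weight:
  fixes h :: "'a \<Rightarrow> ennreal"
  assumes "l \<in> prob_simplex J" "finite S" "\<mu> ` {1..J} \<subseteq> S"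
  shows "(\<Sum>j=1..J. ennreal (l j) * h (\<mu> j)) = (\<Sum>a\<in>S. ennreal (atom_weight J l \<mu> a) * h a)"
proof -
  have "ennreal (atom_weight J l \<mu> a) = (\<Sum>j=1..J. if \<mu> j = a then ennreal (l j) else 0)" for a
    unfolding atom_weight_def using assms(1)
    by (subst sum_ennreal[symmetric]) (auto simp: prob_simplex_def intro!: sum.cong)
  then have "(\<Sum>a\<in>S. ennreal (atom_weight J l \<mu> a) * h a)
      = (\<Sum>a\<in>S. \<Sum>j=1..J. if \<mu> j = a then ennreal (l j) * h a else 0)"
    by (auto simp: sum_distrib_right intro!: sum.cong)
  also have "\<dots> = (\<Sum>j=1..J. \<Sum>a\<in>S. if \<mu> j = a then ennreal (l j) * h a else 0)"
    by (rule sum.swap)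
  also have "\<dots> = (\<Sum>j=1..J. ennreal (l j) * h (\<mu> j))"
    using assms by (intro sum.cong) (auto simp: image_subset_iff)
  finally show ?thesis by simp
qed

text \<open>A mixture is built from the sums \<open>\<Sum>j. l j * \<mu> j B\<close>, and those can be grouped by atom.\<close>

lemma mixture_cong_atom_weight:
  assumes "l0 \<in> prob_simplex J0" "l1 \<in> prob_simplex J1"
    and "atom_weight J0 l0 \<mu>0 = atom_weight J1 l1 \<mu>1"
  shows "mixture \<Omega> J0 l0 \<mu>0 = mixture \<Omega> J1 l1 \<mu>1"
proof -
  let ?S = "\<mu>0 ` {1..J0} \<union> \<mu>1 ` {1..J1}"
  have "(\<Sum>j=1..J0. ennreal (l0 j) * emeasure (\<mu>0 j) B)
      = (\<Sum>j=1..J1. ennreal (l1 j) * emeasure (\<mu>1 j) B)" for B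
    using sum_ennreal_atom_weight[OF assms(1), of ?S \<mu>0 "\<lambda>m. emeasure m B"]
      sum_ennreal_atom_weight[OF assms(2), of ?S \<mu>1 "\<lambda>m. emeasure m B"] assms(3)
    by simp
  then show ?thesis unfolding mixture_def by simp
qed

text \<open>Identifiability speaks of representations without repetitions or zero weights; this lemma
  makes it applicable to all of them.\<close>

lemma normalised_rep:
  assumes rep: "mixture_rep A J l \<mu>"
  obtains J' l' \<mu>' where "mixture_rep A J' l' \<mu>'" "\<forall>j\<in>{1..J'}. 0 < l' j" "inj_on \<mu>' {1..J'}"
    "atom_weight J' l' \<mu>' = atom_weight J l \<mu>"
proof -
  let ?f = "atom_weight J l \<mu>"
  define S where "S = {a \<in> \<mu> ` {1..J}. 0 < ?f a}"
  have l: "l \<in> prob_simplex J" and mem: "\<And>j. j \<in> {1..J} \<Longrightarrow> \<mu> j \<in> A"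
    using rep by (auto simp: mixture_rep_def)
  have fin: "finite S" and SA: "S \<subseteq> A" and pos: "\<And>a. a \<in> S \<Longrightarrow> 0 < ?f a"
    using mem by (auto simp: S_def)
  have f0: "?f a = 0" if "a \<notin> S" for a
    using that atom_weight_nonneg[OF l, of \<mu> a] atom_weight_eq_0[of a \<mu> J l] by (fastforce simp: S_def)
  have "(\<Sum>a\<in>S. ?f a) = (\<Sum>a\<in>\<mu> ` {1..J}. ?f a)"
    using f0 by (intro sum.mono_neutral_left) (auto simp: S_def)
  then have f1: "(\<Sum>a\<in>S. ?f a) = 1"
    using sum_atom_weight[of "\<mu> ` {1..J}" \<mu> J l] l by (simp add: prob_simplex_def)
  obtain h where h: "bij_betw h {1..card S} S"
    using ex_bij_betw_nat_finite_1[OF fin] by blast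
  have hS: "h j \<in> S" if "j \<in> {1..card S}" for j
    using h that by (auto dest: bij_betwE)
  have reindex: "(\<Sum>j=1..card S. g (h j)) = (\<Sum>a\<in>S. g a)" for g :: "_ \<Rightarrow> real"
    using sum.reindex_bij_betw[OF h, of g] .
  have le1: "?f a \<le> 1" if "a \<in> S" for a
    using member_le_sum[OF that, of ?f] f1 fin by (simp add: atom_weight_nonneg[OF l])
  have "S \<noteq> {}" using f1 by auto
  then have "1 \<le> card S"
    using fin by (simp add: Suc_le_eq card_gt_0_iff)
  moreover have "(\<lambda>j. ?f (h j)) \<in> prob_simplex (card S)"
    unfolding prob_simplex_def mem_Collect_eq reindex[of ?f]
    by (intro conjI ballI atom_weight_nonneg[OF l] le1 hS f1)
  moreover have "\<forall>j\<in>{1..card S}. h j \<in> A"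
    using hS SA by blast
  ultimately have "mixture_rep A (card S) (\<lambda>j. ?f (h j)) h"
    unfolding mixture_rep_def by blast
  moreover have "\<forall>j\<in>{1..card S}. 0 < ?f (h j)"
    using hS pos by blast
  moreover have "inj_on h {1..card S}"
    using h by (rule bij_betw_imp_inj_on)
  moreover have "atom_weight (card S) (\<lambda>j. ?f (h j)) h a = ?f a" for a
  proof -
    have "atom_weight (card S) (\<lambda>j. ?f (h j)) h a = (\<Sum>b\<in>S. if b = a then ?f b else 0)"
      unfolding atom_weight_def[of "card S"] by (rule reindex)
    also have "\<dots> = ?f a"
      using f0[of a] fin by simp
    finally show ?thesis .
  qed
  ultimately show ?thesis using that by blast
qed

lemma atom_weight_permute:
  assumes p: "bij_betw p {1..J0} {1..J1}"
    and eq: "\<forall>j\<in>{1..J0}. l0 j = l1 (p j) \<and> \<mu>0 j = \<mu>1 (p j)"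
  shows "atom_weight J0 l0 \<mu>0 = atom_weight J1 l1 \<mu>1"
proof
  fix a
  have "atom_weight J0 l0 \<mu>0 a = (\<Sum>j=1..J0. if \<mu>1 (p j) = a then l1 (p j) else 0)"
    unfolding atom_weight_def using eq by (intro sum.cong) auto
  also have "\<dots> = atom_weight J1 l1 \<mu>1 a"
    unfolding atom_weight_def by (rule sum.reindex_bij_betw[OF p])
  finally show "atom_weight J0 l0 \<mu>0 a = atom_weight J1 l1 \<mu>1 a" .
qed

lemma identifiable_mixture_eq_iff:
  assumes id: "identifiable \<Omega> A"
    and rep0: "mixture_rep A J0 l0 \<mu>0" and rep1: "mixture_rep A J1 l1 \<mu>1"
  shows "mixture \<Omega> J0 l0 \<mu>0 = mixture \<Omega> J1 l1 \<mu>1 \<longleftrightarrow>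
    atom_weight J0 l0 \<mu>0 = atom_weight J1 l1 \<mu>1"
proof
  assume "atom_weight J0 l0 \<mu>0 = atom_weight J1 l1 \<mu>1"
  then show "mixture \<Omega> J0 l0 \<mu>0 = mixture \<Omega> J1 l1 \<mu>1"
    using rep0 rep1 mixture_cong_atom_weight unfolding mixture_rep_def by blast
next
  assume eq: "mixture \<Omega> J0 l0 \<mu>0 = mixture \<Omega> J1 l1 \<mu>1"
  obtain K0 k0 \<kappa>0 where n0: "mixture_rep A K0 k0 \<kappa>0" "\<forall>j\<in>{1..K0}. 0 < k0 j"
      "inj_on \<kappa>0 {1..K0}" and w0: "atom_weight K0 k0 \<kappa>0 = atom_weight J0 l0 \<mu>0"
    using normalised_rep[OF rep0] .
  obtain K1 k1 \<kappa>1 where n1: "mixture_rep A K1 k1 \<kappa>1" "\<forall>j\<in>{1..K1}. 0 < k1 j"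
      "inj_on \<kappa>1 {1..K1}" and w1: "atom_weight K1 k1 \<kappa>1 = atom_weight J1 l1 \<mu>1"
    using normalised_rep[OF rep1] .
  have "mixture \<Omega> K0 k0 \<kappa>0 = mixture \<Omega> J0 l0 \<mu>0"
    using n0(1) rep0 w0 mixture_cong_atom_weight unfolding mixture_rep_def by blast
  moreover have "mixture \<Omega> K1 k1 \<kappa>1 = mixture \<Omega> J1 l1 \<mu>1"
    using n1(1) rep1 w1 mixture_cong_atom_weight unfolding mixture_rep_def by blast
  ultimately have "mixture \<Omega> K0 k0 \<kappa>0 = mixture \<Omega> K1 k1 \<kappa>1"
    using eq by simp
  then obtain p where "bij_betw p {1..K0} {1..K1}"
      "\<forall>j\<in>{1..K0}. k0 j = k1 (p j) \<and> \<kappa>0 j = \<kappa>1 (p j)"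
    using id n0 n1 unfolding identifiable_def by blast
  then have "atom_weight K0 k0 \<kappa>0 = atom_weight K1 k1 \<kappa>1"
    by (rule atom_weight_permute)
  then show "atom_weight J0 l0 \<mu>0 = atom_weight J1 l1 \<mu>1"
    using w0 w1 by simp
qed

text \<open>When two families of weights induce the same weights on atoms, mass can stay at its atom:
  inside the fibre of each atom take the normalised product of the two families.\<close>

lemma diagonal_coupling:
  assumes l0: "l0 \<in> prob_simplex J0" and l1: "l1 \<in> prob_simplex J1"
    and eq: "atom_weight J0 l0 \<mu>0 = atom_weight J1 l1 \<mu>1"
  obtains w where "w \<in> couplings J0 l0 J1 l1" "\<And>i j. \<mu>0 i \<noteq> \<mu>1 j \<Longrightarrow> w i j = 0"
proof
  let ?f = "atom_weight J0 l0 \<mu>0"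
  let ?w = "\<lambda>i j. if \<mu>0 i = \<mu>1 j then l0 i * l1 j / ?f (\<mu>0 i) else 0"
  have nonneg: "0 \<le> ?w i j" if "i \<in> {1..J0}" "j \<in> {1..J1}" for i j
  proof -
    have "0 \<le> l0 i" "0 \<le> l1 j"
      using that l0 l1 by (auto simp: prob_simplex_def)
    then show ?thesis
      by (simp add: atom_weight_nonneg[OF l0])
  qed
  have rows: "(\<Sum>j=1..J1. ?w i j) = l0 i" if i: "i \<in> {1..J0}" for i
  proof -
    have "(\<Sum>j=1..J1. ?w i j) = (\<Sum>j=1..J1. l0 i / ?f (\<mu>0 i) * (if \<mu>1 j = \<mu>0 i then l1 j else 0))"
      by (intro sum.cong) auto
    also have "\<dots> = l0 i / ?f (\<mu>0 i) * ?f (\<mu>0 i)"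
      by (subst sum_distrib_left[symmetric]) (simp only: eq atom_weight_def)
    also have "\<dots> = l0 i"
    proof (cases "l0 i = 0")
      case False
      then have "0 < l0 i" using l0 i by (auto simp: prob_simplex_def less_le)
      then show ?thesis using atom_weight_pos[OF l0 i, of \<mu>0] by simp
    qed simp
    finally show ?thesis .
  qed
  have cols: "(\<Sum>i=1..J0. ?w i j) = l1 j" if j: "j \<in> {1..J1}" for j
  proof -
    have "(\<Sum>i=1..J0. ?w i j) = (\<Sum>i=1..J0. l1 j / ?f (\<mu>1 j) * (if \<mu>0 i = \<mu>1 j then l0 i else 0))"
      by (intro sum.cong) auto
    also have "\<dots> = l1 j / ?f (\<mu>1 j) * ?f (\<mu>1 j)"
      by (subst sum_distrib_left[symmetric]) (simp only: atom_weight_def)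
    also have "\<dots> = l1 j"
    proof (cases "l1 j = 0")
      case False
      then have "0 < l1 j" using l1 j by (auto simp: prob_simplex_def less_le)
      then show ?thesis using atom_weight_pos[OF l1 j, of \<mu>1] by (simp add: eq)
    qed simp
    finally show ?thesis .
  qed
  show "?w \<in> couplings J0 l0 J1 l1"
    unfolding couplings_def using nonneg rows cols by blast
  show "?w i j = 0" if "\<mu>0 i \<noteq> \<mu>1 j" for i j
    using that by simp
qed

text \<open>Mass that leaves the atom \<open>a\<close> pays at least \<open>\<delta>\<close> per unit, so the cost controls how much
  more weight \<open>a\<close> carries at the source than at the target.\<close>

lemma atom_weight_le_cost:
  assumes w: "w \<in> couplings J0 l0 J1 l1"
    and c0: "\<And>i j. i \<in> {1..J0} \<Longrightarrow> j \<in> {1..J1} \<Longrightarrow> 0 \<le> c i j"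
    and c1: "\<And>i j. i \<in> {1..J0} \<Longrightarrow> j \<in> {1..J1} \<Longrightarrow> \<mu>0 i \<noteq> \<mu>1 j \<Longrightarrow> \<delta> \<le> c i j"
    and "0 \<le> \<delta>"
  shows "\<delta> * atom_weight J0 l0 \<mu>0 a \<le> \<delta> * atom_weight J1 l1 \<mu>1 a + coupling_cost J0 J1 c w"
proof -
  let ?L = "\<lambda>i j. if \<mu>0 i = a then w i j else 0"
  let ?R = "\<lambda>i j. if \<mu>1 j = a then w i j else 0"
  have w_nonneg: "0 \<le> w i j" if "i \<in> {1..J0}" "j \<in> {1..J1}" for i j
    using w that by (auto simp: couplings_def)
  have "atom_weight J0 l0 \<mu>0 a = (\<Sum>i=1..J0. \<Sum>j=1..J1. ?L i j)"
    unfolding atom_weight_def using w by (intro sum.cong) (auto simp: couplings_def)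
  moreover have "atom_weight J1 l1 \<mu>1 a = (\<Sum>j=1..J1. \<Sum>i=1..J0. ?R i j)"
    unfolding atom_weight_def using w by (intro sum.cong) (auto simp: couplings_def)
  then have "atom_weight J1 l1 \<mu>1 a = (\<Sum>i=1..J0. \<Sum>j=1..J1. ?R i j)"
    by (subst sum.swap)
  moreover have "\<delta> * ?L i j \<le> \<delta> * ?R i j + w i j * c i j"
    if "i \<in> {1..J0}" "j \<in> {1..J1}" for i j
    using w_nonneg[OF that] c0[OF that] c1[OF that] \<open>0 \<le> \<delta>\<close>
      mult_left_mono[OF c1[OF that] w_nonneg[OF that]]
    by (auto simp: mult.commute)
  then have "(\<Sum>i=1..J0. \<Sum>j=1..J1. \<delta> * ?L i j)
      \<le> (\<Sum>i=1..J0. \<Sum>j=1..J1. \<delta> * ?R i j + w i j * c i j)"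
    by (intro sum_mono) auto
  ultimately show ?thesis
    by (simp add: coupling_cost_def sum_distrib_left sum.distrib)
qed

section \<open>The distance between representations\<close>

locale atom_metric =
  fixes A :: "'x::topological_space measure set" and W :: "'x measure \<Rightarrow> 'x measure \<Rightarrow> real" and \<phi> :: "real \<Rightarrow> real"
  assumes metric: "metric_on A W" and phi: "\<phi> \<in> MI"
begin

lemma
  shows W_nonneg: "a \<in> A \<Longrightarrow> b \<in> A \<Longrightarrow> 0 \<le> W a b"
    and W_commute: "a \<in> A \<Longrightarrow> b \<in> A \<Longrightarrow> W a b = W b a"
    and W_zero: "a \<in> A \<Longrightarrow> b \<in> A \<Longrightarrow> W a b = 0 \<longleftrightarrow> a = b"
    and W_triangle: "a \<in> A \<Longrightarrow> b \<in> A \<Longrightarrow> c \<in> A \<Longrightarrow> W a c \<le> W a b + W b c"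
proof -
  interpret Metric_space A "\<lambda>x y. if x \<in> A \<and> y \<in> A then W x y else 0"
    using metric unfolding metric_on_def .
  show "a \<in> A \<Longrightarrow> b \<in> A \<Longrightarrow> 0 \<le> W a b" using nonneg[of a b] by simp
  show "a \<in> A \<Longrightarrow> b \<in> A \<Longrightarrow> W a b = W b a" using commute[of a b] by simp
  show "a \<in> A \<Longrightarrow> b \<in> A \<Longrightarrow> W a b = 0 \<longleftrightarrow> a = b" using zero[of a b] by simp
  show "a \<in> A \<Longrightarrow> b \<in> A \<Longrightarrow> c \<in> A \<Longrightarrow> W a c \<le> W a b + W b c" using triangle[of a b c] by simp
qed

abbreviation cost where
  "cost J0 \<mu>0 J1 \<mu>1 \<equiv> coupling_cost J0 J1 (\<lambda>i j. \<phi> (W (\<mu>0 i) (\<mu>1 j)))"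

definition min_cost where
  "min_cost J0 l0 \<mu>0 J1 l1 \<mu>1 = (INF w\<in>couplings J0 l0 J1 l1. cost J0 \<mu>0 J1 \<mu>1 w)"

abbreviation dist_rep where
  "dist_rep \<equiv> rep_dist W \<phi>"

lemma dist_rep_eq: "dist_rep J0 l0 \<mu>0 J1 l1 \<mu>1 = nonneg_inv \<phi> (min_cost J0 l0 \<mu>0 J1 l1 \<mu>1)"
  unfolding rep_dist_def min_cost_def coupling_cost_def ..

context
  fixes J0 J1 l0 l1 \<mu>0 \<mu>1
  assumes rep0: "mixture_rep A J0 l0 \<mu>0" and rep1: "mixture_rep A J1 l1 \<mu>1"
begin

lemma simplex: "l0 \<in> prob_simplex J0" "l1 \<in> prob_simplex J1"
  using rep0 rep1 by (auto simp: mixture_rep_def)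

lemma atoms: "i \<in> {1..J0} \<Longrightarrow> \<mu>0 i \<in> A" "j \<in> {1..J1} \<Longrightarrow> \<mu>1 j \<in> A"
  using rep0 rep1 by (auto simp: mixture_rep_def)

lemma phi_W_nonneg: "i \<in> {1..J0} \<Longrightarrow> j \<in> {1..J1} \<Longrightarrow> 0 \<le> \<phi> (W (\<mu>0 i) (\<mu>1 j))"
  using atoms by (intro MI_nonneg[OF phi] W_nonneg)

lemma cost_nonneg: "w \<in> couplings J0 l0 J1 l1 \<Longrightarrow> 0 \<le> cost J0 \<mu>0 J1 \<mu>1 w"
  by (rule coupling_cost_nonneg) (auto intro: phi_W_nonneg)

lemma couplings_nonempty: "couplings J0 l0 J1 l1 \<noteq> {}"
  using product_coupling[OF simplex] by blast

lemma min_cost_nonneg: "0 \<le> min_cost J0 l0 \<mu>0 J1 l1 \<mu>1"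
  unfolding min_cost_def using couplings_nonempty cost_nonneg by (intro cINF_greatest)

lemma min_cost_le: "w \<in> couplings J0 l0 J1 l1 \<Longrightarrow> min_cost J0 l0 \<mu>0 J1 l1 \<mu>1 \<le> cost J0 \<mu>0 J1 \<mu>1 w"
  unfolding min_cost_def using cost_nonneg by (intro cINF_lower bdd_belowI2) auto

lemma min_cost_less:
  assumes "min_cost J0 l0 \<mu>0 J1 l1 \<mu>1 < r"
  obtains w where "w \<in> couplings J0 l0 J1 l1" "cost J0 \<mu>0 J1 \<mu>1 w < r"
  using assms cInf_lessD[of "cost J0 \<mu>0 J1 \<mu>1 ` couplings J0 l0 J1 l1" r] couplings_nonempty
  unfolding min_cost_def by blast

lemma dist_rep_nonneg: "0 \<le> dist_rep J0 l0 \<mu>0 J1 l1 \<mu>1"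
  unfolding dist_rep_eq by (rule MI_inv_nonneg[OF phi min_cost_nonneg])

lemma phi_dist_rep: "\<phi> (dist_rep J0 l0 \<mu>0 J1 l1 \<mu>1) = min_cost J0 l0 \<mu>0 J1 l1 \<mu>1"
  unfolding dist_rep_eq by (rule MI_f_inv[OF phi min_cost_nonneg])

lemma dist_rep_le:
  "w \<in> couplings J0 l0 J1 l1 \<Longrightarrow> dist_rep J0 l0 \<mu>0 J1 l1 \<mu>1 \<le> nonneg_inv \<phi> (cost J0 \<mu>0 J1 \<mu>1 w)"
  unfolding dist_rep_eq by (rule MI_inv_mono[OF phi min_cost_nonneg min_cost_le])

text \<open>Near-optimal couplings for the distance itself. The slack \<open>\<epsilon>\<close> is spent before applying
  \<open>\<phi>\<close>: by strict monotonicity \<open>\<phi> (D + \<epsilon>)\<close> lies above the infimum of the costs, so some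
  coupling costs less than that.\<close>

lemma dist_rep_approx:
  assumes "0 < \<epsilon>"
  obtains w where "w \<in> couplings J0 l0 J1 l1"
    "nonneg_inv \<phi> (cost J0 \<mu>0 J1 \<mu>1 w) < dist_rep J0 l0 \<mu>0 J1 l1 \<mu>1 + \<epsilon>"
proof -
  let ?D = "dist_rep J0 l0 \<mu>0 J1 l1 \<mu>1"
  have "min_cost J0 l0 \<mu>0 J1 l1 \<mu>1 < \<phi> (?D + \<epsilon>)"
    using MI_less_iff[OF phi, of ?D "?D + \<epsilon>"] dist_rep_nonneg assms phi_dist_rep by simp
  then obtain w where w: "w \<in> couplings J0 l0 J1 l1" "cost J0 \<mu>0 J1 \<mu>1 w < \<phi> (?D + \<epsilon>)"
    by (rule min_cost_less)
  have "nonneg_inv \<phi> (cost J0 \<mu>0 J1 \<mu>1 w) < ?D + \<epsilon>"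
    using w(2) MI_less_iff[OF phi, of "nonneg_inv \<phi> (cost J0 \<mu>0 J1 \<mu>1 w)" "?D + \<epsilon>"]
      cost_nonneg[OF w(1)] dist_rep_nonneg assms
    by (simp add: MI_f_inv[OF phi] MI_inv_nonneg[OF phi])
  with w(1) show ?thesis using that by blast
qed

lemma dist_rep_zero_iff:
  "dist_rep J0 l0 \<mu>0 J1 l1 \<mu>1 = 0 \<longleftrightarrow> min_cost J0 l0 \<mu>0 J1 l1 \<mu>1 = 0"
  using phi_dist_rep MI_zero[OF phi] dist_rep_eq MI_inv_f[OF phi, of 0] by auto

end

lemma dist_rep_commute:
  assumes rep0: "mixture_rep A J0 l0 \<mu>0" and rep1: "mixture_rep A J1 l1 \<mu>1"
  shows "dist_rep J0 l0 \<mu>0 J1 l1 \<mu>1 = dist_rep J1 l1 \<mu>1 J0 l0 \<mu>0"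
proof -
  have cost: "cost J1 \<mu>1 J0 \<mu>0 (\<lambda>j i. w i j) = cost J0 \<mu>0 J1 \<mu>1 w" for w
    unfolding coupling_cost_def using atoms[OF rep0 rep1]
    by (subst sum.swap) (auto intro!: sum.cong simp: W_commute)
  have "cost J0 \<mu>0 J1 \<mu>1 ` couplings J0 l0 J1 l1 = cost J1 \<mu>1 J0 \<mu>0 ` couplings J1 l1 J0 l0"
    (is "?X = ?Y")
  proof
    show "?X \<subseteq> ?Y"
      using transpose_coupling by (force simp flip: cost)
    show "?Y \<subseteq> ?X"
    proof
      fix y assume "y \<in> ?Y"
      then obtain v where v: "v \<in> couplings J1 l1 J0 l0" "y = cost J1 \<mu>1 J0 \<mu>0 v" by blast
      then have "y = cost J0 \<mu>0 J1 \<mu>1 (\<lambda>i j. v j i)"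
        using cost[of "\<lambda>i j. v j i"] by simp
      with transpose_coupling[OF v(1)] show "y \<in> ?X" by blast
    qed
  qed
  then show ?thesis unfolding dist_rep_eq min_cost_def by simp
qed

text \<open>The triangle inequality for \<open>W\<close> holds under the glued plan at every triple of indices;
  Jensen's inequality then moves the average over triples inside
  \<open>(x, y) \<mapsto> \<phi> (\<phi>\<inverse> x + \<phi>\<inverse> y)\<close>.\<close>

lemma glued_cost:
  assumes rep0: "mixture_rep A J0 l0 \<mu>0" and rep1: "mixture_rep A J1 l1 \<mu>1"
    and rep2: "mixture_rep A J2 l2 \<mu>2"
    and w: "w \<in> couplings J0 l0 J1 l1" and v: "v \<in> couplings J1 l1 J2 l2"
  obtains u where "u \<in> couplings J0 l0 J2 l2"
    "cost J0 \<mu>0 J2 \<mu>2 u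
      \<le> \<phi> (nonneg_inv \<phi> (cost J0 \<mu>0 J1 \<mu>1 w) + nonneg_inv \<phi> (cost J1 \<mu>1 J2 \<mu>2 v))"
proof -
  note at = atoms[OF rep0 rep1] atoms(2)[OF rep0 rep2]
  obtain g where g0: "\<And>i j k. i \<in> {1..J0} \<Longrightarrow> j \<in> {1..J1} \<Longrightarrow> k \<in> {1..J2} \<Longrightarrow> 0 \<le> g i j k"
    and gw: "\<And>i j. i \<in> {1..J0} \<Longrightarrow> j \<in> {1..J1} \<Longrightarrow> (\<Sum>k=1..J2. g i j k) = w i j"
    and gv: "\<And>j k. j \<in> {1..J1} \<Longrightarrow> k \<in> {1..J2} \<Longrightarrow> (\<Sum>i=1..J0. g i j k) = v j k"
    using glue_couplings[OF w v] by blast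
  let ?u = "\<lambda>i k. \<Sum>j=1..J1. g i j k"
  let ?S = "{1..J0} \<times> {1..J1} \<times> {1..J2}"
  let ?p = "\<lambda>(i, j, k). g i j k"
  let ?x = "\<lambda>(i, j, k). W (\<mu>0 i) (\<mu>1 j)"
  let ?y = "\<lambda>(i, j, k). W (\<mu>1 j) (\<mu>2 k)"
  have triple: "(\<Sum>s\<in>?S. f s) = (\<Sum>i=1..J0. \<Sum>j=1..J1. \<Sum>k=1..J2. f (i, j, k))" for f :: "_ \<Rightarrow> real"
    by (simp add: sum.cartesian_product case_prod_unfold)
  have "(\<Sum>k=1..J2. ?u i k) = l0 i" if "i \<in> {1..J0}" for i
  proof -
    have "(\<Sum>k=1..J2. ?u i k) = (\<Sum>j=1..J1. w i j)"
      using gw that by (subst sum.swap) (auto intro!: sum.cong)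
    then show ?thesis using w that by (simp add: couplings_def)
  qed
  moreover have "(\<Sum>i=1..J0. ?u i k) = l2 k" if "k \<in> {1..J2}" for k
  proof -
    have "(\<Sum>i=1..J0. ?u i k) = (\<Sum>j=1..J1. v j k)"
      using gv that by (subst sum.swap) (auto intro!: sum.cong)
    then show ?thesis using v that by (simp add: couplings_def)
  qed
  ultimately have u: "?u \<in> couplings J0 l0 J2 l2"
    using g0 by (auto simp: couplings_def intro!: sum_nonneg)
  have cost_w: "(\<Sum>s\<in>?S. ?p s * \<phi> (?x s)) = cost J0 \<mu>0 J1 \<mu>1 w"
    unfolding triple coupling_cost_def
    by (intro sum.cong) (auto simp flip: gw sum_distrib_right)
  have "(\<Sum>s\<in>?S. ?p s * \<phi> (?y s))
      = (\<Sum>j=1..J1. \<Sum>k=1..J2. \<Sum>i=1..J0. g i j k * \<phi> (W (\<mu>1 j) (\<mu>2 k)))"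
    unfolding triple prod.case
    by (subst sum.swap, rule sum.cong[OF refl], rule sum.swap)
  also have "\<dots> = cost J1 \<mu>1 J2 \<mu>2 v"
    unfolding coupling_cost_def by (intro sum.cong) (auto simp flip: gv sum_distrib_right)
  finally have cost_v: "(\<Sum>s\<in>?S. ?p s * \<phi> (?y s)) = cost J1 \<mu>1 J2 \<mu>2 v" .
  have "(\<Sum>s\<in>?S. ?p s) = (\<Sum>i=1..J0. \<Sum>j=1..J1. w i j)"
    unfolding triple using gw by (auto intro!: sum.cong)
  also have "\<dots> = (\<Sum>i=1..J0. l0 i)"
    using w by (auto simp: couplings_def intro!: sum.cong)
  finally have p1: "(\<Sum>s\<in>?S. ?p s) = 1"
    using simplex(1)[OF rep0 rep1] by (simp add: prob_simplex_def)
  have "cost J0 \<mu>0 J2 \<mu>2 ?u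
      = (\<Sum>i=1..J0. \<Sum>k=1..J2. \<Sum>j=1..J1. g i j k * \<phi> (W (\<mu>0 i) (\<mu>2 k)))"
    by (simp add: coupling_cost_def sum_distrib_right)
  also have "\<dots> = (\<Sum>i=1..J0. \<Sum>j=1..J1. \<Sum>k=1..J2. g i j k * \<phi> (W (\<mu>0 i) (\<mu>2 k)))"
    by (rule sum.cong[OF refl], rule sum.swap)
  also have "\<dots> \<le> (\<Sum>i=1..J0. \<Sum>j=1..J1. \<Sum>k=1..J2.
      g i j k * \<phi> (W (\<mu>0 i) (\<mu>1 j) + W (\<mu>1 j) (\<mu>2 k)))"
    using g0 at by (intro sum_mono mult_left_mono) (simp_all add: MI_le_iff[OF phi] W_nonneg W_triangle)
  also have "\<dots> = (\<Sum>s\<in>?S. ?p s * \<phi> (?x s + ?y s))"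
    unfolding triple prod.case ..
  also have "\<dots> \<le> \<phi> (nonneg_inv \<phi> (\<Sum>s\<in>?S. ?p s * \<phi> (?x s)) + nonneg_inv \<phi> (\<Sum>s\<in>?S. ?p s * \<phi> (?y s)))"
    using g0 at W_nonneg by (intro MI_Jensen[OF phi _ _ p1]) auto
  finally show ?thesis
    using that[OF u] unfolding cost_w cost_v by blast
qed

lemma dist_rep_triangle:
  assumes rep0: "mixture_rep A J0 l0 \<mu>0" and rep1: "mixture_rep A J1 l1 \<mu>1"
    and rep2: "mixture_rep A J2 l2 \<mu>2"
  shows "dist_rep J0 l0 \<mu>0 J2 l2 \<mu>2 \<le> dist_rep J0 l0 \<mu>0 J1 l1 \<mu>1 + dist_rep J1 l1 \<mu>1 J2 l2 \<mu>2"
proof (rule field_le_epsilon)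
  fix \<epsilon> :: real assume "0 < \<epsilon>"
  then have half: "0 < \<epsilon> / 2" by simp
  obtain w where w: "w \<in> couplings J0 l0 J1 l1"
    and wD: "nonneg_inv \<phi> (cost J0 \<mu>0 J1 \<mu>1 w) < dist_rep J0 l0 \<mu>0 J1 l1 \<mu>1 + \<epsilon> / 2"
    using dist_rep_approx[OF rep0 rep1 half] .
  obtain v where v: "v \<in> couplings J1 l1 J2 l2"
    and vD: "nonneg_inv \<phi> (cost J1 \<mu>1 J2 \<mu>2 v) < dist_rep J1 l1 \<mu>1 J2 l2 \<mu>2 + \<epsilon> / 2"
    using dist_rep_approx[OF rep1 rep2 half] .
  let ?r = "nonneg_inv \<phi> (cost J0 \<mu>0 J1 \<mu>1 w) + nonneg_inv \<phi> (cost J1 \<mu>1 J2 \<mu>2 v)"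
  obtain u where u: "u \<in> couplings J0 l0 J2 l2" and uD: "cost J0 \<mu>0 J2 \<mu>2 u \<le> \<phi> ?r"
    using glued_cost[OF rep0 rep1 rep2 w v] .
  have "0 \<le> ?r"
    using cost_nonneg[OF rep0 rep1 w] cost_nonneg[OF rep1 rep2 v] MI_inv_nonneg[OF phi] by simp
  then have "nonneg_inv \<phi> (cost J0 \<mu>0 J2 \<mu>2 u) \<le> ?r"
    using MI_inv_mono[OF phi cost_nonneg[OF rep0 rep2 u] uD] MI_inv_f[OF phi] by simp
  with dist_rep_le[OF rep0 rep2 u] wD vD
  show "dist_rep J0 l0 \<mu>0 J2 l2 \<mu>2 \<le> dist_rep J0 l0 \<mu>0 J1 l1 \<mu>1 + dist_rep J1 l1 \<mu>1 J2 l2 \<mu>2 + \<epsilon>"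
    by linarith
qed

text \<open>Distinct atoms have positive distance, and a representation has finitely many of them, so
  \<open>\<delta>\<close> below is a positive lower bound for the cost of moving a unit of mass away from its
  atom.\<close>

lemma atom_weight_le_if_min_cost_zero:
  assumes rep0: "mixture_rep A J0 l0 \<mu>0" and rep1: "mixture_rep A J1 l1 \<mu>1"
    and zero: "min_cost J0 l0 \<mu>0 J1 l1 \<mu>1 = 0"
  shows "atom_weight J0 l0 \<mu>0 a \<le> atom_weight J1 l1 \<mu>1 a"
proof -
  define P where "P = {(i, j) \<in> {1..J0} \<times> {1..J1}. \<mu>0 i \<noteq> \<mu>1 j}"
  \<comment> \<open>The element \<open>1\<close> covers the case that no two distinct atoms occur.\<close>
  define \<delta> where "\<delta> = Min (insert 1 ((\<lambda>(i, j). \<phi> (W (\<mu>0 i) (\<mu>1 j))) ` P))"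
  have fin: "finite P" unfolding P_def by (rule finite_subset[of _ "{1..J0} \<times> {1..J1}"]) auto
  have pos: "0 < \<phi> (W (\<mu>0 i) (\<mu>1 j))" if "(i, j) \<in> P" for i j
  proof -
    have at: "\<mu>0 i \<in> A" "\<mu>1 j \<in> A" "\<mu>0 i \<noteq> \<mu>1 j"
      using that atoms[OF rep0 rep1] by (auto simp: P_def)
    then have "0 < W (\<mu>0 i) (\<mu>1 j)"
      using W_nonneg[OF at(1,2)] W_zero[OF at(1,2)] by simp
    then show ?thesis
      using MI_less_iff[OF phi, of 0 "W (\<mu>0 i) (\<mu>1 j)"] MI_zero[OF phi] by simp
  qed
  have \<delta>: "0 < \<delta>"
    using fin pos unfolding \<delta>_def by auto
  have \<delta>_le: "\<delta> \<le> \<phi> (W (\<mu>0 i) (\<mu>1 j))" if "i \<in> {1..J0}" "j \<in> {1..J1}" "\<mu>0 i \<noteq> \<mu>1 j" for i j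
  proof -
    have "(i, j) \<in> P" using that by (simp add: P_def)
    then show ?thesis using fin unfolding \<delta>_def by (intro Min_le) force+
  qed
  have "\<delta> * atom_weight J0 l0 \<mu>0 a \<le> \<delta> * atom_weight J1 l1 \<mu>1 a"
  proof (rule field_le_epsilon)
    fix \<epsilon> :: real assume "0 < \<epsilon>"
    then obtain w where w: "w \<in> couplings J0 l0 J1 l1" and "cost J0 \<mu>0 J1 \<mu>1 w < \<epsilon>"
      using min_cost_less[OF rep0 rep1] zero by auto
    moreover have "\<delta> * atom_weight J0 l0 \<mu>0 a \<le> \<delta> * atom_weight J1 l1 \<mu>1 a + cost J0 \<mu>0 J1 \<mu>1 w"
      using w phi_W_nonneg[OF rep0 rep1] \<delta>_le \<delta> by (intro atom_weight_le_cost) auto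
    ultimately show "\<delta> * atom_weight J0 l0 \<mu>0 a \<le> \<delta> * atom_weight J1 l1 \<mu>1 a + \<epsilon>" by linarith
  qed
  with \<delta> show ?thesis by simp
qed

lemma dist_rep_eq_0_iff:
  assumes rep0: "mixture_rep A J0 l0 \<mu>0" and rep1: "mixture_rep A J1 l1 \<mu>1"
  shows "dist_rep J0 l0 \<mu>0 J1 l1 \<mu>1 = 0 \<longleftrightarrow> atom_weight J0 l0 \<mu>0 = atom_weight J1 l1 \<mu>1"
proof
  assume D: "dist_rep J0 l0 \<mu>0 J1 l1 \<mu>1 = 0"
  then have "min_cost J0 l0 \<mu>0 J1 l1 \<mu>1 = 0" and "min_cost J1 l1 \<mu>1 J0 l0 \<mu>0 = 0"
    using dist_rep_zero_iff[OF rep0 rep1] dist_rep_zero_iff[OF rep1 rep0]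
      dist_rep_commute[OF rep0 rep1] by simp_all
  then have le: "atom_weight J0 l0 \<mu>0 a \<le> atom_weight J1 l1 \<mu>1 a"
      "atom_weight J1 l1 \<mu>1 a \<le> atom_weight J0 l0 \<mu>0 a" for a
    using atom_weight_le_if_min_cost_zero rep0 rep1 by blast+
  show "atom_weight J0 l0 \<mu>0 = atom_weight J1 l1 \<mu>1"
    using le by (intro ext antisym)
next
  assume "atom_weight J0 l0 \<mu>0 = atom_weight J1 l1 \<mu>1"
  then obtain w where w: "w \<in> couplings J0 l0 J1 l1" and off: "\<And>i j. \<mu>0 i \<noteq> \<mu>1 j \<Longrightarrow> w i j = 0"
    using diagonal_coupling[OF simplex[OF rep0 rep1]] by blast
  have z: "w i j * \<phi> (W (\<mu>0 i) (\<mu>1 j)) = 0" if "i \<in> {1..J0}" "j \<in> {1..J1}" for i j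
    using off[of i j] W_zero[of "\<mu>0 i" "\<mu>1 j"] atoms[OF rep0 rep1] that MI_zero[OF phi]
    by (cases "\<mu>0 i = \<mu>1 j") auto
  have "cost J0 \<mu>0 J1 \<mu>1 w = 0"
    unfolding coupling_cost_def by (intro sum.neutral ballI z)
  then show "dist_rep J0 l0 \<mu>0 J1 l1 \<mu>1 = 0"
    using min_cost_le[OF rep0 rep1 w] min_cost_nonneg[OF rep0 rep1]
    by (simp add: dist_rep_zero_iff[OF rep0 rep1])
qed

section \<open>The metric on mixtures\<close>

text \<open>In a pseudometric, points at distance zero have the same distance to every third point.\<close>

lemma dist_rep_cong_left:
  assumes rep0: "mixture_rep A J0 l0 \<mu>0" and rep0': "mixture_rep A J0' l0' \<mu>0'"
    and eq: "atom_weight J0 l0 \<mu>0 = atom_weight J0' l0' \<mu>0'"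
    and rep1: "mixture_rep A J1 l1 \<mu>1"
  shows "dist_rep J0 l0 \<mu>0 J1 l1 \<mu>1 = dist_rep J0' l0' \<mu>0' J1 l1 \<mu>1"
  using dist_rep_triangle[OF rep0 rep0' rep1] dist_rep_triangle[OF rep0' rep0 rep1]
    dist_rep_eq_0_iff[OF rep0 rep0'] dist_rep_eq_0_iff[OF rep0' rep0] eq
  by simp

lemma mixture_dist_eq_dist_rep:
  assumes id: "identifiable \<Omega> A"
    and rep0: "mixture_rep A J0 l0 \<mu>0" and rep1: "mixture_rep A J1 l1 \<mu>1"
  shows "mixture_dist \<Omega> A W \<phi> (mixture \<Omega> J0 l0 \<mu>0) (mixture \<Omega> J1 l1 \<mu>1)
    = dist_rep J0 l0 \<mu>0 J1 l1 \<mu>1"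
proof -
  have "dist_rep K0 k0 \<kappa>0 K1 k1 \<kappa>1 = dist_rep J0 l0 \<mu>0 J1 l1 \<mu>1"
    if r0: "mixture_rep A K0 k0 \<kappa>0" "mixture \<Omega> J0 l0 \<mu>0 = mixture \<Omega> K0 k0 \<kappa>0"
      and r1: "mixture_rep A K1 k1 \<kappa>1" "mixture \<Omega> J1 l1 \<mu>1 = mixture \<Omega> K1 k1 \<kappa>1"
    for K0 k0 \<kappa>0 K1 k1 \<kappa>1
  proof -
    have eq: "atom_weight J0 l0 \<mu>0 = atom_weight K0 k0 \<kappa>0" "atom_weight J1 l1 \<mu>1 = atom_weight K1 k1 \<kappa>1"
      using identifiable_mixture_eq_iff[OF id] rep0 rep1 r0 r1 by blast+
    have "dist_rep J0 l0 \<mu>0 J1 l1 \<mu>1 = dist_rep K0 k0 \<kappa>0 J1 l1 \<mu>1"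
      by (rule dist_rep_cong_left[OF rep0 r0(1) eq(1) rep1])
    also have "\<dots> = dist_rep J1 l1 \<mu>1 K0 k0 \<kappa>0"
      by (rule dist_rep_commute[OF r0(1) rep1])
    also have "\<dots> = dist_rep K1 k1 \<kappa>1 K0 k0 \<kappa>0"
      by (rule dist_rep_cong_left[OF rep1 r1(1) eq(2) r0(1)])
    also have "\<dots> = dist_rep K0 k0 \<kappa>0 K1 k1 \<kappa>1"
      by (rule dist_rep_commute[OF r1(1) r0(1)])
    finally show ?thesis by simp
  qed
  then show ?thesis
    unfolding mixture_dist_def using rep0 rep1 by (intro the_equality) blast+
qed

lemma metric_on_mixtures:
  assumes id: "identifiable \<Omega> A"
  shows "metric_on (mixtures \<Omega> A) (mixture_dist \<Omega> A W \<phi>)"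
  unfolding metric_on_def
proof
  note md = mixture_dist_eq_dist_rep[OF id]
  let ?M = "mixtures \<Omega> A" and ?d = "mixture_dist \<Omega> A W \<phi>"
  have ex: "\<exists>J l \<mu>. mixture_rep A J l \<mu> \<and> x = mixture \<Omega> J l \<mu>" if "x \<in> ?M" for x
    using that unfolding mixtures_def by blast
  show "0 \<le> (if x \<in> ?M \<and> y \<in> ?M then ?d x y else 0)" for x y
    using ex[of x] ex[of y] md dist_rep_nonneg by (auto split: if_splits)
  show "(if x \<in> ?M \<and> y \<in> ?M then ?d x y else 0) = (if y \<in> ?M \<and> x \<in> ?M then ?d y x else 0)" for x y
    using ex[of x] ex[of y] md dist_rep_commute by (auto split: if_splits)
  show "(if x \<in> ?M \<and> y \<in> ?M then ?d x y else 0) = 0 \<longleftrightarrow> x = y" if "x \<in> ?M" "y \<in> ?M" for x y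
    using that ex[of x] ex[of y] md dist_rep_eq_0_iff identifiable_mixture_eq_iff[OF id] by auto
  show "(if x \<in> ?M \<and> z \<in> ?M then ?d x z else 0)
      \<le> (if x \<in> ?M \<and> y \<in> ?M then ?d x y else 0) + (if y \<in> ?M \<and> z \<in> ?M then ?d y z else 0)"
    if "x \<in> ?M" "y \<in> ?M" "z \<in> ?M" for x y z
    using that ex[of x] ex[of y] ex[of z] md dist_rep_triangle by auto
qed

end

theorem theorem3p9:
  fixes \<Omega> :: "'x::polish_space set"
    and A :: "'x measure set"
    and W :: "'x measure \<Rightarrow> 'x measure \<Rightarrow> real"
    and \<phi> :: "real \<Rightarrow> real"
  assumes "\<Omega> \<in> sets borel"
    and "A \<noteq> {}"
    and "A \<subseteq> borel_probs \<Omega>"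
    and "identifiable \<Omega> A"
    and "metric_on A W"
    and "\<phi> \<in> MI"
  shows "(\<forall>J0 l0 \<mu>0 J1 l1 \<mu>1.
            mixture_rep A J0 l0 \<mu>0 \<and> mixture_rep A J1 l1 \<mu>1 \<longrightarrow>
            mixture_dist \<Omega> A W \<phi> (mixture \<Omega> J0 l0 \<mu>0) (mixture \<Omega> J1 l1 \<mu>1) =
              rep_dist W \<phi> J0 l0 \<mu>0 J1 l1 \<mu>1) \<and>
         metric_on (mixtures \<Omega> A) (mixture_dist \<Omega> A W \<phi>)"
proof -
  interpret atom_metric A W \<phi>
    using assms(5,6) by (rule atom_metric.intro)
  show ?thesis
    using mixture_dist_eq_dist_rep[OF assms(4)] metric_on_mixtures[OF assms(4)] by blast
qed

end
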